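(* Let $\ell>0$ and let $L\in\mathbb{R}^{M\times M}$ be a graph or finite-difference Laplacian matrix with $L\mathbf 1=0$. Assume that $I+\ell^2L$ is invertible and that $$\|(I+\ell^2L)^{-1}g\|_{\ell^\infty}\le\|g\|_{\ell^\infty}\qquad\text{for all }g\in\mathbb{R}^M .$$ Let $\chi\in\{0,1\}^M$, $f\in[0,1]^M$, and $w=(I+\ell^2L)^{-1}f$. If $$\|f-\chi\|_{\ell^\infty}+\ell^2\|L\chi\|_{\ell^\infty}<\frac12 ,$$ then $\mathbf 1_{\{w_i>1/2\}}=\chi_i$ for every $i=1,\dots,M$.
   Context: $\mathbf 1\in\mathbb{R}^M$ denotes the all-ones vector in the condition $L\mathbf 1=0$; $\mathbf 1_{\{w_i>1/2\}}$ equals $1$ if $w_i>1/2$ and $0$ otherwise. $\|g\|_{\ell^\infty}=\max_i|g_i|$. The sign convention is that $L$ is a discretization of $-\Delta$, so $I+\ell^2L$ is the discrete analogue of $I-\ell^2\Delta$. The only properties required of $L$ are that it is a real $M\times M$ matrix with $L\mathbf 1=0$ and that the stated resolvent contraction holds. *)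

theory Defs
  imports "HOL-Analysis.Analysis"
begin

end

(* Writing A = I + l^2 L, the error is w - chi = A^{-1} (f - A chi) = A^{-1} (f - chi - l^2 L chi),
   so the contraction bounds every |w_i - chi_i| strictly by 1/2. *)
theory Submission
  imports Defs
begin

text \<open>With \<open>A\<close> = I + l^2 L, the mask \<open>chi\<close> is itself a filtered
  vector, that of \<open>A *v chi\<close>. So \<open>w\<close> and \<open>chi\<close> are images of
  \<open>f\<close> and \<open>A *v chi\<close> under one linear sup-norm contraction, and are no
  farther apart than these inputs.\<close>

theorem mainTheorem5:
  fixes l :: real
    and L :: "real ^ 'm ^ 'm"
    and chi f w :: "real ^ 'm"
  assumes "l > 0"
    and "L *v (\<chi> i. 1) = 0"
    and "invertible (mat 1 + l\<^sup>2 *\<^sub>R L)"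
    and "\<And>g :: real ^ 'm. infnorm (matrix_inv (mat 1 + l\<^sup>2 *\<^sub>R L) *v g) \<le> infnorm g"
    and "\<And>i. chi $ i \<in> {0, 1}"
    and "\<And>i. f $ i \<in> {0..1}"
    and "w = matrix_inv (mat 1 + l\<^sup>2 *\<^sub>R L) *v f"
    and "infnorm (f - chi) + l\<^sup>2 * infnorm (L *v chi) < 1 / 2"
  shows "\<forall>i. (if w $ i > 1 / 2 then 1 else 0) = chi $ i"
proof
  fix i
  define A where "A = mat 1 + l\<^sup>2 *\<^sub>R L"
  have A_chi: "A *v chi = chi + l\<^sup>2 *\<^sub>R (L *v chi)"
    by (simp add: A_def matrix_vector_mult_add_rdistrib scaleR_matrix_vector_assoc)
  \<comment> \<open>\<open>matrix_inv\<close> is a Hilbert choice, so invertibility is what makes it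
    an actual inverse.\<close>
  have "matrix_inv A ** A = mat 1"
    using assms(3) unfolding A_def invertible_def matrix_inv_def by (rule someI2_ex) simp
  then have "matrix_inv A *v (A *v chi) = chi"
    by (simp add: matrix_vector_mul_assoc)
  then have "w - chi = matrix_inv A *v (f - A *v chi)"
    by (simp add: assms(7) A_def matrix_vector_mult_diff_distrib)
  then have "infnorm (w - chi) \<le> infnorm (f - A *v chi)"
    using assms(4) by (simp add: A_def)
  also have "\<dots> = infnorm ((f - chi) + - (l\<^sup>2 *\<^sub>R (L *v chi)))"
    by (simp add: A_chi algebra_simps)
  also have "\<dots> \<le> infnorm (f - chi) + infnorm (- (l\<^sup>2 *\<^sub>R (L *v chi)))"
    by (rule infnorm_triangle)
  also have "\<dots> = infnorm (f - chi) + l\<^sup>2 * infnorm (L *v chi)"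
    by (simp add: infnorm_neg infnorm_mul)
  also have "\<dots> < 1 / 2"
    by (rule assms(8))
  finally have "\<bar>w $ i - chi $ i\<bar> < 1 / 2"
    using component_le_infnorm_cart[of "w - chi" i] by simp
  \<comment> \<open>Strictness excludes a tie at the threshold: \<open>w $ i\<close> lies below 1/2
    if \<open>chi $ i\<close> is 0 and above it if \<open>chi $ i\<close> is 1.\<close>
  then show "(if w $ i > 1 / 2 then 1 else 0) = chi $ i"
    using assms(5)[of i] by auto
qed

end
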